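(* Let $T=(\lambda_n)_{n\ge0}$ be a multiplier sequence with $\lambda_n>0$ for all $n\ge 0$. For $n\ge0$ define $$\mathfrak{p}_n^T(x)=\sum_{j=0}^n\lambda_j\, j!\,S(n,j)\,x^j,$$ where $S(n,j)$ are the Stirling numbers of the second kind. (Then $\mathfrak{p}_n^T$ has a zero at $0$ and $n-1$ simple negative zeros.) For $1\le m\le n-1$ let $\zeta_m^T(n)$ denote the $m$-th negative zero of $\mathfrak{p}_n^T$, ordered in decreasing size. Then for every positive integer $m$, $$\lim_{n\to\infty}\frac{\zeta_m^T(n)}{-\frac{\lambda_m}{\lambda_{m+1}}\left(\frac{m}{m+1}\right)^{n}}=1.$$
   Context: A sequence $T=(\lambda_n)_n$ of real numbers is a multiplier sequence if, whenever a real polynomial $p(x)=\sum_{j=0}^n a_jx^j$ has only real zeros, the polynomial $T(p)(x)=\sum_{j=0}^n\lambda_ja_jx^j$ also has only real zeros. The Stirling numbers of the second kind are $S(n,j)=\sum_{i=0}^j\frac{(-1)^{j-i}i^n}{(j-i)!\,i!}$. *)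

theory Defs
  imports
    Complex_Main
    "HOL-Computational_Algebra.Polynomial"
    "HOL-Combinatorics.Stirling"
begin

text \<open>All complex zeros of a real polynomial are real. The zero polynomial is counted as
  real-rooted, as is customary in the theory of multiplier sequences (\<open>T(p)\<close> may vanish
  identically when some of the multipliers are zero); for sequences without zero entries the
  convention has no effect.\<close>

definition real_rooted :: "real poly \<Rightarrow> bool" where
  "real_rooted p \<longleftrightarrow>
     p = 0 \<or> (\<forall>z::complex. poly (map_poly complex_of_real p) z = 0 \<longrightarrow> z \<in> \<real>)"

definition diag_op :: "(nat \<Rightarrow> real) \<Rightarrow> real poly \<Rightarrow> real poly" where
  "diag_op lam p = (\<Sum>j\<le>degree p. monom (lam j * coeff p j) j)"

definition multiplier_sequence :: "(nat \<Rightarrow> real) \<Rightarrow> bool" where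
  "multiplier_sequence lam \<longleftrightarrow> (\<forall>p. real_rooted p \<longrightarrow> real_rooted (diag_op lam p))"

definition stirling_poly :: "(nat \<Rightarrow> real) \<Rightarrow> nat \<Rightarrow> real poly" where
  "stirling_poly lam n = (\<Sum>j\<le>n. monom (lam j * fact j * real (Stirling n j)) j)"

definition neg_zeros :: "real poly \<Rightarrow> real set" where
  "neg_zeros p = {x. x < 0 \<and> poly p x = 0}"

text \<open>The \<open>m\<close>-th negative zero in decreasing order, counted from \<open>m = 1\<close>, the zero
  closest to \<open>0\<close>. Meaningful only for \<open>1 \<le> m \<le> n - 1\<close>; outside this range the
  value is irrelevant.\<close>

definition zeta :: "(nat \<Rightarrow> real) \<Rightarrow> nat \<Rightarrow> nat \<Rightarrow> real" where
  "zeta lam m n = rev (sorted_list_of_set (neg_zeros (stirling_poly lam n))) ! (m - 1)"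

text \<open>The recursively defined library function \<^const>\<open>Stirling\<close> agrees with the explicit formula
  for the Stirling numbers of the second kind (with \<open>0 ^ 0 = 1\<close>).\<close>

lemma Stirling_explicit:
  "real (Stirling n j) = (\<Sum>i\<le>j. (-1) ^ (j - i) * real i ^ n / (fact (j - i) * fact i))"
proof (induction n j rule: Stirling.induct)
  case 1
  show ?case by simp
next
  case (2 k)
  have "(\<Sum>i\<le>Suc k. (-1) ^ (Suc k - i) * real i ^ 0 / (fact (Suc k - i) * fact i))
      = (\<Sum>i\<le>Suc k. real (Suc k choose i) * 1 ^ i * (-1) ^ (Suc k - i) / fact (Suc k))"
    by (intro sum.cong) (simp_all add: binomial_fact del: fact_Suc)
  also have "\<dots> = (1 + (-1)) ^ Suc k / fact (Suc k)"
    by (subst binomial_ring) (simp only: sum_divide_distrib)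
  finally show ?case by simp
next
  case (3 n)
  show ?case by simp
next
  case (4 n k)
  let ?t = "\<lambda>n j i. (-1) ^ (j - i) * real i ^ n / (fact (j - i) * fact i) :: real"
  have "?t (Suc n) (Suc k) i = real (Suc k) * ?t n (Suc k) i + ?t n k i" if "i \<le> k" for i
  proof -
    have d: "Suc k - i = Suc (k - i)" using that by simp
    have r: "real i = real (Suc k) - real (Suc (k - i))" using that by simp
    have "?t (Suc n) (Suc k) i = real i * ?t n (Suc k) i" by simp
    also have "\<dots> = real (Suc k) * ?t n (Suc k) i - real (Suc (k - i)) * ?t n (Suc k) i"
      by (subst r) (rule left_diff_distrib)
    also have "real (Suc (k - i)) * ?t n (Suc k) i = - ?t n k i"
      unfolding d by (simp add: field_simps del: of_nat_Suc)
    finally show ?thesis by simp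
  qed
  then have "(\<Sum>i\<le>k. ?t (Suc n) (Suc k) i)
      = real (Suc k) * (\<Sum>i\<le>k. ?t n (Suc k) i) + (\<Sum>i\<le>k. ?t n k i)"
    by (simp add: sum.distrib sum_distrib_left del: of_nat_Suc fact_Suc)
  moreover have "?t (Suc n) (Suc k) (Suc k) = real (Suc k) * ?t n (Suc k) (Suc k)"
    by simp
  ultimately have "(\<Sum>i\<le>Suc k. ?t (Suc n) (Suc k) i)
      = real (Suc k) * (\<Sum>i\<le>Suc k. ?t n (Suc k) i) + (\<Sum>i\<le>k. ?t n k i)"
    by (simp only: sum.atMost_Suc distrib_left)
  then show ?case
    using 4 by (simp only: Stirling.simps of_nat_add of_nat_mult)
qed

end

theory Submission
  imports Defs "HOL-Computational_Algebra.Fundamental_Theorem_Algebra"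
begin

text \<open>For \<open>lam = 1\<close> the polynomials satisfy \<open>F\<^sub>n\<^sub>+\<^sub>1 = x ((1 + x) F\<^sub>n)'\<close>, so Rolle's theorem gives
  \<open>n\<close> distinct zeros in \<open>(-1, 0]\<close>; a positive multiplier sequence keeps zeros real and, by a
  perturbation argument, simple. Asymptotically the coefficient of \<open>x\<^sup>j\<close> is \<open>lam j * j ^ n\<close>, and at
  \<open>x = - y * (lam m / lam (m + 1)) * (m / (m + 1)) ^ n\<close> the terms of index \<open>m\<close> and \<open>m + 1\<close>
  dominate, in proportion \<open>1 : - y\<close>. The sign change at \<open>y = 1\<close> locates a zero, and Rolle's theorem
  applied to the derivative of order \<open>m + 1\<close> shows that at most \<open>m\<close> negative zeros have
  \<open>y < 2\<close>, so the located zero is the \<open>m\<close>-th one.\<close>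

section \<open>Real-rooted polynomials\<close>

lemma map_poly_of_real_mult:
  "map_poly complex_of_real (p * q) = map_poly complex_of_real p * map_poly complex_of_real q"
  by (intro poly_eqI) (simp add: coeff_map_poly coeff_mult)

lemma poly_map_poly_of_real:
  "poly (map_poly complex_of_real p) (of_real x) = of_real (poly p x)"
  by (induction p) (simp_all add: map_poly_pCons)

lemma pderiv_linear_mult:
  "pderiv ([:-a, 1:] * g) = [:-a, 1:] * pderiv g + (g :: real poly)"
proof -
  have "pderiv [:-a, 1:] = 1" by (simp add: pderiv_pCons)
  then show ?thesis by (simp only: pderiv_mult mult_1_right)
qed

lemma real_rooted_factor:
  assumes "real_rooted (p * q)" "p * q \<noteq> 0"
  shows "real_rooted p"
  using assms by (auto simp: real_rooted_def map_poly_of_real_mult)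

lemma real_rooted_ex_root:
  assumes "real_rooted p" "degree p > 0"
  shows "\<exists>a. poly p a = 0"
proof -
  have "degree (map_poly complex_of_real p) = degree p"
    by (rule degree_map_poly) auto
  then have "\<not> constant (poly (map_poly complex_of_real p))"
    using assms(2) by (simp add: constant_degree)
  then obtain z where z: "poly (map_poly complex_of_real p) z = 0"
    using fundamental_theorem_of_algebra by blast
  then obtain x where "z = of_real x"
    using assms by (force simp: real_rooted_def elim: Reals_cases)
  with z show ?thesis
    using poly_map_poly_of_real by (metis of_real_eq_0_iff)
qed

text \<open>A real root can be split off as long as the degree is positive, and the cofactor is
  real-rooted again. The zero polynomial falls under the constant case, so \<open>g\<close> is
  nonzero in the other one.\<close>

lemma real_rooted_induct [consumes 1, case_names const factor]:
  assumes "real_rooted p"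
    and "\<And>c. P [:c:]"
    and "\<And>a g. real_rooted g \<Longrightarrow> g \<noteq> 0 \<Longrightarrow> P g \<Longrightarrow> P ([:-a, 1:] * g)"
  shows "P p"
  using assms(1)
proof (induction "degree p" arbitrary: p)
  case 0
  then obtain c where "p = [:c:]"
    by (metis degree_eq_zeroE)
  with assms(2) show ?case by simp
next
  case (Suc d)
  then obtain a where "poly p a = 0"
    using real_rooted_ex_root by (metis zero_less_Suc)
  then obtain g where p: "p = [:-a, 1:] * g"
    by (metis poly_eq_0_iff_dvd dvdE)
  have g: "g \<noteq> 0" using p Suc(2) by auto
  have "degree p = Suc (degree g)"
    unfolding p using g by (subst degree_mult_eq) auto
  moreover have "real_rooted g"
    using real_rooted_factor[of g "[:-a, 1:]"] Suc.prems Suc(2) p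
    by (metis mult.commute degree_0 nat.distinct(1))
  ultimately show ?case
    using Suc(1)[of g] Suc(2) g assms(3)[of g a] p by auto
qed

text \<open>Writing \<open>p = (x - a) g\<close> gives
  \<open>p'^2 - p p'' = (x - a)^2 (g'^2 - g g'') + g^2\<close>, so the inequality passes from
  \<open>g\<close> to \<open>p\<close>. It serves twice: to exclude multiple zeros and to obtain
  log-concavity.\<close>

lemma real_rooted_Laguerre:
  assumes "real_rooted p"
  shows "poly p x * poly (pderiv (pderiv p)) x \<le> (poly (pderiv p) x)\<^sup>2"
  using assms
proof (induction rule: real_rooted_induct)
  case (const c)
  show ?case by (simp add: pderiv_pCons)
next
  case (factor a g)
  let ?g = "poly g x" and ?g1 = "poly (pderiv g) x" and ?g2 = "poly (pderiv (pderiv g)) x"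
  have d: "poly (pderiv ([:-a, 1:] * g)) x = (x - a) * ?g1 + ?g"
    unfolding pderiv_linear_mult by (simp add: algebra_simps)
  have d2: "poly (pderiv (pderiv ([:-a, 1:] * g))) x = (x - a) * ?g2 + 2 * ?g1"
    unfolding pderiv_linear_mult pderiv_add by (simp add: algebra_simps)
  have "((x - a) * ?g1 + ?g)\<^sup>2 - (x - a) * ?g * ((x - a) * ?g2 + 2 * ?g1)
      = (x - a)\<^sup>2 * (?g1\<^sup>2 - ?g * ?g2) + ?g\<^sup>2"
    by (simp add: power2_eq_square algebra_simps)
  moreover have "\<dots> \<ge> 0"
    using factor.IH by simp
  moreover have "poly ([:-a, 1:] * g) x = (x - a) * ?g" by (simp add: algebra_simps)
  ultimately show ?case unfolding d d2 by (simp only:)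
qed

text \<open>Simplicity at \<open>a\<close> makes \<open>poly g a\<close> nonzero, so every linear
  factor contributes a new root.\<close>

lemma card_roots_simple_real_rooted:
  assumes "real_rooted p" "\<And>x. poly p x = 0 \<Longrightarrow> poly (pderiv p) x \<noteq> 0"
  shows "card {x. poly p x = 0} = degree p"
  using assms
proof (induction rule: real_rooted_induct)
  case (const c)
  \<comment> \<open>For \<open>c = 0\<close> every point would be a root with vanishing
    derivative.\<close>
  then have "c \<noteq> 0" by (auto simp: pderiv_pCons)
  then show ?case by simp
next
  case (factor a g)
  have d: "poly (pderiv ([:-a, 1:] * g)) x = (x - a) * poly (pderiv g) x + poly g x" for x
    unfolding pderiv_linear_mult by (simp add: algebra_simps)
  have a: "poly g a \<noteq> 0" using factor.prems[of a] unfolding d by simp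
  have "card {x. poly g x = 0} = degree g"
  proof (rule factor.IH)
    fix x assume "poly g x = 0"
    then show "poly (pderiv g) x \<noteq> 0"
      using factor.prems[of x] unfolding d by auto
  qed
  moreover have "{x. poly ([:-a, 1:] * g) x = 0} = insert a {x. poly g x = 0}"
    by (auto simp: algebra_simps)
  moreover have "degree ([:-a, 1:] * g) = Suc (degree g)"
    using factor by (subst degree_mult_eq) auto
  ultimately show ?case
    using a factor poly_roots_finite[of g] by (simp del: poly_mult mult_pCons_left)
qed

text \<open>There are at most \<open>degree p\<close> complex zeros, so the real ones already
  exhaust them. The hypothesis is an inequality because after a perturbation only an upper bound for
  the degree is at hand.\<close>

lemma real_rooted_if_card_roots:
  assumes "p \<noteq> 0" "card {x. poly p x = 0} \<ge> degree p"
  shows "real_rooted p"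
proof -
  let ?P = "map_poly complex_of_real p"
  have P: "?P \<noteq> 0" using assms(1) by (simp add: map_poly_eq_0_iff)
  have dP: "degree ?P = degree p" by (rule degree_map_poly) auto
  let ?A = "complex_of_real ` {x. poly p x = 0}"
  have "card ?A = card {x. poly p x = 0}"
    by (intro card_image) (auto intro: inj_onI)
  moreover have "card {z. poly ?P z = 0} \<le> degree ?P"
    using P by (rule card_poly_roots_bound)
  moreover have "?A \<subseteq> {z. poly ?P z = 0}"
    by (auto simp: poly_map_poly_of_real)
  ultimately have "?A = {z. poly ?P z = 0}"
    using assms(2) dP P by (intro card_seteq poly_roots_finite) auto
  moreover have "?A \<subseteq> \<real>" by auto
  ultimately show ?thesis unfolding real_rooted_def by blast
qed

section \<open>Counting zeros of derivatives\<close>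

text \<open>Induction by splitting off the largest zero: with \<open>b\<close> generalised, the
  induction hypothesis yields critical points strictly left of the second largest zero, and the mean
  value theorem adds a new one between the two largest.\<close>

lemma Rolle_card:
  fixes p :: "real poly"
  assumes "finite S" "card S = Suc k" "S \<subseteq> {a..b}" "\<And>x. x \<in> S \<Longrightarrow> poly p x = 0"
  shows "\<exists>S'. finite S' \<and> card S' = k \<and> S' \<subseteq> {a<..<b} \<and> (\<forall>x\<in>S'. poly (pderiv p) x = 0)"
  using assms
proof (induction k arbitrary: S b)
  case 0
  show ?case by (rule exI[of _ "{}"]) simp
next
  case (Suc k)
  let ?M = "Max S" let ?T = "S - {?M}"
  have M: "?M \<in> S" using Suc.prems by (intro Max_in) auto
  have cT: "card ?T = Suc k" using Suc.prems M by simp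
  then have "?T \<noteq> {}" by (metis card.empty Zero_not_Suc)
  then have N: "Max ?T \<in> ?T" using Suc.prems by (intro Max_in) auto
  have NM: "Max ?T < ?M"
    using N Suc.prems by (metis DiffE Max_ge insertI1 order_le_imp_less_or_eq)
  have "x \<le> Max ?T" if "x \<in> ?T" for x using that Suc.prems by (intro Max_ge) auto
  then have "?T \<subseteq> {a..Max ?T}" using Suc.prems by (meson DiffE atLeastAtMost_iff subset_iff)
  then obtain S' where S': "finite S'" "card S' = k" "S' \<subseteq> {a<..<Max ?T}"
      "\<forall>x\<in>S'. poly (pderiv p) x = 0"
    using Suc.IH[of ?T "Max ?T"] cT Suc.prems by auto
  obtain x where x: "Max ?T < x" "x < ?M" "poly (pderiv p) x = 0"
    using poly_MVT[OF NM, of p] N M Suc.prems NM by auto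
  have bds: "a \<le> Max ?T" "?M \<le> b" using N M Suc.prems by auto
  have "x \<notin> S'" using x S' by auto
  then show ?case
    using S' x bds by (intro exI[of _ "insert x S'"]) auto
qed

text \<open>Each differentiation costs one zero.\<close>

lemma Rolle_card_higher:
  fixes p :: "real poly"
  assumes "finite S" "card S = k + Suc l" "S \<subseteq> {a..b}" "\<And>x. x \<in> S \<Longrightarrow> poly p x = 0"
  shows "\<exists>S'. finite S' \<and> card S' = Suc l \<and> S' \<subseteq> {a..b} \<and> (\<forall>x\<in>S'. poly ((pderiv ^^ k) p) x = 0)"
  using assms
proof (induction k arbitrary: S p)
  case 0
  then show ?case by auto
next
  case (Suc k)
  obtain S' where "finite S'" "card S' = k + Suc l" "S' \<subseteq> {a<..<b}"
      "\<forall>x\<in>S'. poly (pderiv p) x = 0"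
    using Rolle_card[of S "k + Suc l" a b p] Suc.prems by auto
  moreover from this have "S' \<subseteq> {a..b}" by auto
  ultimately show ?case
    using Suc.IH[of S' "pderiv p"] by (simp add: funpow_swap1)
qed

section \<open>Stability of simple real roots\<close>

text \<open>Each simple root survives, up to a small displacement, since the sign change around it does.\<close>

lemma eventually_root_near:
  fixes p q :: "real poly"
  assumes "poly p a = 0" "poly (pderiv p) a \<noteq> 0" "e > 0"
  shows "eventually (\<lambda>t. \<exists>x. \<bar>x - a\<bar> < e \<and> poly (p + smult t q) x = 0) (nhds 0)"
proof -
  obtain g where p: "p = [:-a, 1:] * g"
    using assms(1) by (metis poly_eq_0_iff_dvd dvdE)
  have "poly g a \<noteq> 0" using assms(2) unfolding p pderiv_linear_mult by simp
  then have "0 < poly g a * poly g a" by (auto simp: zero_less_mult_iff)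
  moreover have "isCont (\<lambda>h. poly g (a - h) * poly g (a + h)) 0"
    by (intro continuous_intros)
  ultimately have "eventually (\<lambda>h. 0 < poly g (a - h) * poly g (a + h)) (nhds 0)"
    using order_tendstoD(1)[of "\<lambda>h. poly g (a - h) * poly g (a + h)" _ "nhds 0" 0]
    by (simp add: continuous_at tendsto_nhds_iff)
  then obtain d where d: "d > 0" "\<And>h. \<bar>h\<bar> < d \<Longrightarrow> 0 < poly g (a - h) * poly g (a + h)"
    by (auto simp: eventually_nhds_metric dist_real_def)
  \<comment> \<open>\<open>h < d\<close> gives \<open>g\<close> the same sign at
    \<open>a - h\<close> and \<open>a + h\<close>, so \<open>p\<close> changes sign between them;
    \<open>h < e\<close> keeps the root found close enough to \<open>a\<close>.\<close>
  define h where "h = min d e / 2"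
  have h: "0 < h" "h < d" "h < e" using d assms by (auto simp: h_def)
  have "poly p (a - h) * poly p (a + h) = - h\<^sup>2 * (poly g (a - h) * poly g (a + h))"
    unfolding p by (simp add: power2_eq_square algebra_simps)
  also have "\<dots> < 0" using h d(2)[of h] by (simp add: mult_neg_pos)
  finally have "poly p (a - h) * poly p (a + h) < 0" .
  moreover have "isCont (\<lambda>t. poly (p + smult t q) (a - h) * poly (p + smult t q) (a + h)) 0"
    unfolding poly_add poly_smult by (intro continuous_intros)
  ultimately have "eventually (\<lambda>t. poly (p + smult t q) (a - h) * poly (p + smult t q) (a + h) < 0) (nhds 0)"
    using order_tendstoD(2)[of "\<lambda>t. poly (p + smult t q) (a - h) * poly (p + smult t q) (a + h)" _ "nhds 0" 0]
    by (simp add: continuous_at tendsto_nhds_iff)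
  then show ?thesis
  proof eventually_elim
    case (elim t)
    then obtain x where "a - h < x" "x < a + h" "poly (p + smult t q) x = 0"
      using poly_IVT[of "a - h" "a + h" "p + smult t q"] h by auto
    then show ?case using h by (intro exI[of _ x]) auto
  qed
qed

text \<open>Roots of \<open>p\<close> are at least \<open>2 * e\<close> apart, so the nearby roots
  of the perturbed polynomial are distinct. Its degree does not exceed that of \<open>p\<close>,
  hence they are all its roots.\<close>

lemma eventually_real_rooted_perturb:
  fixes p q :: "real poly"
  assumes p: "degree p > 0" "card {x. poly p x = 0} = degree p"
    and simple: "\<And>x. poly p x = 0 \<Longrightarrow> poly (pderiv p) x \<noteq> 0"
    and q: "degree q \<le> degree p"
  shows "eventually (\<lambda>t. real_rooted (p + smult t q)) (nhds 0)"
proof -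
  let ?R = "{x. poly p x = 0}"
  have p0: "p \<noteq> 0" using p by auto
  have fin: "finite ?R" using poly_roots_finite[OF p0] .
  have "\<exists>e>0. \<forall>a\<in>?R. \<forall>b\<in>?R. a \<noteq> b \<longrightarrow> 2 * e \<le> \<bar>a - b\<bar>"
  proof -
    \<comment> \<open>The element 1 keeps the set nonempty when \<open>p\<close> has a single
      root.\<close>
    let ?D = "insert 1 ((\<lambda>(a, b). \<bar>a - b\<bar>) ` (?R \<times> ?R - {(a, b). a = b}))"
    have fD: "finite ?D" using fin by auto
    have "Min ?D > 0" using fD by (subst Min_gr_iff) auto
    moreover have "Min ?D \<le> \<bar>a - b\<bar>" if "a \<in> ?R" "b \<in> ?R" "a \<noteq> b" for a b
      using that by (intro Min_le[OF fD]) force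
    ultimately show ?thesis by (intro exI[of _ "Min ?D / 2"]) auto
  qed
  then obtain e where e: "e > 0" "\<And>a b. a \<in> ?R \<Longrightarrow> b \<in> ?R \<Longrightarrow> a \<noteq> b \<Longrightarrow> 2 * e \<le> \<bar>a - b\<bar>"
    by blast
  \<comment> \<open>A point where \<open>p\<close> does not vanish witnesses that the perturbed
    polynomial is nonzero.\<close>
  obtain y where y: "poly p y \<noteq> 0" using p0 poly_all_0_iff_0 by blast
  have "((\<lambda>t. poly (p + smult t q) y) \<longlongrightarrow> poly (p + smult 0 q) y) (nhds 0)"
    by (simp, intro tendsto_eq_intros) (auto simp: tendsto_ident_at filterlim_def filtermap_ident)
  then have "eventually (\<lambda>t. poly (p + smult t q) y \<noteq> 0) (nhds 0)"
    using y by (intro tendsto_imp_eventually_ne) auto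
  moreover have "eventually (\<lambda>t. \<forall>a\<in>?R. \<exists>x. \<bar>x - a\<bar> < e \<and> poly (p + smult t q) x = 0) (nhds 0)"
    using fin e simple
    by (intro eventually_ball_finite ballI eventually_root_near) auto
  ultimately show ?thesis
  proof eventually_elim
    case (elim t)
    let ?f = "p + smult t q"
    have f0: "?f \<noteq> 0" using elim(1) by (metis poly_0)
    obtain X where X: "\<And>a. a \<in> ?R \<Longrightarrow> \<bar>X a - a\<bar> < e \<and> poly ?f (X a) = 0"
      using elim(2) by metis
    have "inj_on X ?R"
    proof (rule inj_onI, rule ccontr)
      fix a b assume ab: "a \<in> ?R" "b \<in> ?R" "X a = X b" "a \<noteq> b"
      then show False using X[of a] X[of b] e(2)[of a b] by linarith
    qed
    then have "card ?R = card (X ` ?R)" by (simp add: card_image)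
    also have "\<dots> \<le> card {x. poly ?f x = 0}"
      using X f0 by (intro card_mono poly_roots_finite) auto
    finally have "degree p \<le> card {x. poly ?f x = 0}" using p by simp
    moreover have "degree ?f \<le> degree p"
      using q by (intro degree_add_le) (auto intro: order.trans[OF degree_smult_le])
    ultimately show ?case
      using f0 by (intro real_rooted_if_card_roots) auto
  qed
qed

section \<open>Multiplier sequences and simple zeros\<close>

lemma coeff_diag_op: "coeff (diag_op lam p) j = lam j * coeff p j"
proof -
  have "coeff (diag_op lam p) j = (\<Sum>i\<le>degree p. if i = j then lam i * coeff p i else 0)"
    by (simp add: diag_op_def coeff_sum)
  then show ?thesis by (auto simp: coeff_eq_0)
qed

lemma diag_op_add: "diag_op lam (p + q) = diag_op lam p + diag_op lam q"
  by (intro poly_eqI) (simp add: coeff_diag_op algebra_simps)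

lemma diag_op_smult: "diag_op lam (smult c p) = smult c (diag_op lam p)"
  by (intro poly_eqI) (simp add: coeff_diag_op)

lemma degree_diag_op:
  assumes "\<And>n. lam n \<noteq> 0"
  shows "degree (diag_op lam p) = degree p"
proof (rule antisym)
  show "degree (diag_op lam p) \<le> degree p"
    by (rule degree_le) (auto simp: coeff_diag_op coeff_eq_0)
  show "degree p \<le> degree (diag_op lam p)"
  proof (cases "p = 0")
    case False
    then show ?thesis using assms by (intro le_degree) (simp add: coeff_diag_op)
  qed simp
qed

text \<open>A multiple root \<open>x\<^sub>0\<close> of the image would violate Laguerre's inequality at \<open>x\<^sub>0\<close> after the
  perturbation by \<open>t (1 + (x - x\<^sub>0)\<^sup>2 / 2)\<close>, for a suitable sign of \<open>t\<close>; but this perturbation is the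
  image of a perturbation of \<open>p\<close>, which stays real-rooted.\<close>

lemma multiplier_sequence_simple_roots:
  assumes lam: "multiplier_sequence lam" "\<And>n. lam n > 0"
    and p: "degree p > 0" "card {x. poly p x = 0} = degree p"
    and simple: "\<And>x. poly p x = 0 \<Longrightarrow> poly (pderiv p) x \<noteq> 0"
    and root: "poly (diag_op lam p) x0 = 0"
  shows "poly (pderiv (diag_op lam p)) x0 \<noteq> 0"
proof
  let ?f = "diag_op lam p"
  assume root': "poly (pderiv ?f) x0 = 0"
  have nz: "lam n \<noteq> 0" for n using lam(2)[of n] by simp
  have df: "degree ?f = degree p" using nz by (rule degree_diag_op)
  \<comment> \<open>A linear image has a nonzero constant derivative. The bound makes room for a
    quadratic perturbation.\<close>
  have deg: "degree p \<ge> 2"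
  proof (rule ccontr)
    assume "\<not> degree p \<ge> 2"
    then have 1: "degree p = 1" using p by simp
    then have "pderiv ?f = [:coeff ?f 1:]"
      by (intro poly_eqI) (auto simp: coeff_pderiv coeff_pCons df coeff_eq_0 split: nat.splits)
    with root' have "coeff ?f 1 = 0" by simp
    then have "?f = 0" using df 1 by (metis leading_coeff_0_iff)
    then show False using df 1 by simp
  qed
  \<comment> \<open>The expanded form of \<open>1 + (x - x0)^2 / 2\<close>, with value 1, derivative
    0 and second derivative 1 at \<open>x0\<close>.\<close>
  define r :: "real poly" where "r = [:1 + x0\<^sup>2 / 2, - x0, 1 / 2:]"
  have r: "poly r x0 = 1" "poly (pderiv r) x0 = 0" "poly (pderiv (pderiv r)) x0 = 1"
    by (simp_all add: r_def pderiv_pCons power2_eq_square algebra_simps)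
  define q where "q = diag_op (\<lambda>n. inverse (lam n)) r"
  have q: "diag_op lam q = r"
    using nz by (intro poly_eqI) (simp add: q_def coeff_diag_op)
  have "degree q = degree r"
    unfolding q_def using nz by (intro degree_diag_op) simp
  then have "degree q \<le> degree p" using deg by (simp add: r_def)
  then have "eventually (\<lambda>t. real_rooted (p + smult t q)) (nhds 0)"
    using p simple by (intro eventually_real_rooted_perturb) auto
  then obtain d where d: "d > 0" "\<And>t. \<bar>t\<bar> < d \<Longrightarrow> real_rooted (p + smult t q)"
    by (auto simp: eventually_nhds_metric dist_real_def)
  let ?f2 = "poly (pderiv (pderiv ?f)) x0"
  \<comment> \<open>With \<open>t\<close> of the same sign as \<open>?f2\<close>, the product
    \<open>t * (?f2 + t)\<close> is positive, while Laguerre's inequality at \<open>x0\<close> makes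
    it at most 0.\<close>
  define t where "t = (if ?f2 \<ge> 0 then d / 2 else - d / 2)"
  have t: "\<bar>t\<bar> < d" "t \<noteq> 0" "t * ?f2 \<ge> 0"
    using d mult_nonneg_nonneg[of d ?f2] mult_nonneg_nonpos[of d ?f2] by (auto simp: t_def)
  have "diag_op lam (p + smult t q) = ?f + smult t r"
    by (simp add: diag_op_add diag_op_smult q)
  then have "real_rooted (?f + smult t r)"
    using lam(1) d(2)[OF t(1)] unfolding multiplier_sequence_def by metis
  from real_rooted_Laguerre[OF this, of x0]
  have "t * (?f2 + t) \<le> 0"
    using root root' r by (simp add: pderiv_add pderiv_smult)
  moreover have "t * t > 0" using t by (auto simp: zero_less_mult_iff)
  ultimately show False using t(3) by (simp add: algebra_simps)
qed

section \<open>Log-concavity of the multipliers\<close>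

text \<open>The image of \<open>x^k (1 + x)^2\<close> is \<open>x^k\<close> times a quadratic with
  coefficients \<open>lam k\<close>, \<open>2 * lam (k + 1)\<close>, \<open>lam (k + 2)\<close>,
  which must be real-rooted.\<close>

lemma multiplier_sequence_log_concave:
  assumes lam: "multiplier_sequence lam" "\<And>n. lam n > 0"
  shows "lam k * lam (k + 2) \<le> (lam (k + 1))\<^sup>2"
proof -
  have "real_rooted (monom 1 k * [:1, 2, 1:])"
    unfolding real_rooted_def
  proof (intro disjI2 allI impI)
    fix z assume "poly (map_poly complex_of_real (monom 1 k * [:1, 2, 1:])) z = 0"
    then have "z ^ k * (1 + z)\<^sup>2 = 0"
      unfolding map_poly_of_real_mult
      by (simp add: map_poly_monom map_poly_pCons poly_monom power2_eq_square algebra_simps)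
    then have "z = 0 \<or> z = -1"
      by (auto simp: eq_neg_iff_add_eq_0 add.commute)
    then show "z \<in> \<real>" by auto
  qed
  then have "real_rooted (diag_op lam (monom 1 k * [:1, 2, 1:]))"
    using lam(1) by (simp add: multiplier_sequence_def)
  moreover have eq: "diag_op lam (monom 1 k * [:1, 2, 1:])
      = [:lam k, 2 * lam (k + 1), lam (k + 2):] * monom 1 k"
    by (intro poly_eqI)
      (auto simp: coeff_diag_op coeff_monom_mult mult.commute[of _ "monom 1 k"] coeff_pCons
        numeral_2_eq_2 split: nat.splits)
  moreover have "[:lam k, 2 * lam (k + 1), lam (k + 2):] * monom 1 k \<noteq> 0"
    using lam(2)[of k] by (simp add: monom_eq_0_iff del: mult_pCons_left)
  ultimately have "real_rooted [:lam k, 2 * lam (k + 1), lam (k + 2):]"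
    using real_rooted_factor by metis
  \<comment> \<open>At the vertex of the parabola the first derivative vanishes, and Laguerre's
    inequality becomes the discriminant condition.\<close>
  from real_rooted_Laguerre[OF this, of "- lam (k + 1) / lam (k + 2)"]
  have "lam (k + 2) * (lam k - (lam (k + 1))\<^sup>2 / lam (k + 2)) \<le> 0"
    using lam(2)[of "k + 2"]
    by (simp add: pderiv_pCons power2_eq_square field_simps)
  then show ?thesis using lam(2)[of "k + 2"] by (simp add: field_simps)
qed

text \<open>Log-concavity makes the quotients of consecutive terms nonincreasing, so from
  \<open>m\<close> on the first quotient bounds all later ones.\<close>

lemma log_concave_le_geometric:
  fixes lam :: "nat \<Rightarrow> real"
  assumes pos: "\<And>n. lam n > 0"
    and conc: "\<And>k. lam k * lam (k + 2) \<le> (lam (k + 1))\<^sup>2"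
  shows "lam (m + r) \<le> lam m * (lam (Suc m) / lam m) ^ r"
proof -
  have ratio: "lam (Suc (m + r)) / lam (m + r) \<le> lam (Suc m) / lam m" for r
  proof (induction r)
    case (Suc r)
    have "lam (Suc (Suc (m + r))) / lam (Suc (m + r)) \<le> lam (Suc (m + r)) / lam (m + r)"
      using conc[of "m + r"] pos[of "Suc (m + r)"] pos[of "m + r"]
      by (simp add: field_simps power2_eq_square)
    with Suc show ?case by simp
  qed simp
  show ?thesis
  proof (induction r)
    case (Suc r)
    have "lam (m + Suc r) = lam (Suc (m + r)) / lam (m + r) * lam (m + r)"
      using pos[of "m + r"] by simp
    also have "\<dots> \<le> lam (Suc m) / lam m * (lam m * (lam (Suc m) / lam m) ^ r)"
      using ratio[of r] Suc pos[of m] pos[of "Suc m"] pos[of "m + r"]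
      by (intro mult_mono) (auto simp: less_imp_le)
    finally show ?case by simp
  qed simp
qed

section \<open>The polynomials with constant multipliers\<close>

text \<open>These are the geometric or Fubini polynomials; their value at 1 counts ordered set
  partitions.\<close>

abbreviation fubini_poly :: "nat \<Rightarrow> real poly" where
  "fubini_poly \<equiv> stirling_poly (\<lambda>_. 1)"

lemma coeff_stirling_poly: "coeff (stirling_poly lam n) j = lam j * fact j * real (Stirling n j)"
proof -
  have "coeff (stirling_poly lam n) j
      = (\<Sum>i\<le>n. if i = j then lam i * fact i * real (Stirling n i) else 0)"
    by (simp add: stirling_poly_def coeff_sum)
  then show ?thesis by auto
qed

lemma stirling_poly_eq_diag_op: "stirling_poly lam n = diag_op lam (fubini_poly n)"
  by (intro poly_eqI) (simp add: coeff_stirling_poly coeff_diag_op)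

lemma degree_stirling_poly:
  assumes "lam n \<noteq> 0"
  shows "degree (stirling_poly lam n) = n"
proof (rule antisym)
  show "degree (stirling_poly lam n) \<le> n"
    by (rule degree_le) (simp add: coeff_stirling_poly)
  show "n \<le> degree (stirling_poly lam n)"
    using assms by (intro le_degree) (simp add: coeff_stirling_poly)
qed

text \<open>Coefficientwise this is the recurrence for \<open>Stirling\<close>, multiplied by
  \<open>fact j\<close>.\<close>

lemma fubini_poly_Suc:
  "fubini_poly (Suc n) = pCons 0 (pderiv ([:1, 1:] * fubini_poly n))"
proof (rule poly_eqI)
  fix j
  show "coeff (fubini_poly (Suc n)) j = coeff (pCons 0 (pderiv ([:1, 1:] * fubini_poly n))) j"
    by (cases j) (simp_all add: coeff_stirling_poly coeff_pderiv coeff_pCons algebra_simps)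
qed

text \<open>The factor \<open>1 + x\<close> adds the zero -1 to the \<open>n\<close> zeros in
  \<open>(-1, 0]\<close>; Rolle's theorem returns \<open>n\<close> zeros in \<open>(-1, 0)\<close>,
  and the factor \<open>x\<close> restores the zero 0.\<close>

lemma fubini_poly_roots:
  "n \<ge> 1 \<Longrightarrow> \<exists>S. finite S \<and> card S = n \<and> S \<subseteq> {-1<..0} \<and> (\<forall>x\<in>S. poly (fubini_poly n) x = 0)"
proof (induction n rule: nat_induct_at_least)
  case base
  then show ?case
    by (intro exI[of _ "{0}"]) (simp add: poly_0_coeff_0 coeff_stirling_poly)
next
  case (Suc n)
  then obtain S where S: "finite S" "card S = n" "S \<subseteq> {-1<..0}"
    "\<forall>x\<in>S. poly (fubini_poly n) x = 0" by blast
  let ?p = "[:1, 1:] * fubini_poly n"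
  have "-1 \<notin> S" using S by auto
  then obtain S' where S': "finite S'" "card S' = n" "S' \<subseteq> {-1<..<0}"
      "\<forall>x\<in>S'. poly (pderiv ?p) x = 0"
    using Rolle_card[of "insert (-1) S" n "-1" 0 ?p] S by (force simp del: mult_pCons_left)
  have "0 \<notin> S'" using S' by auto
  then show ?case
    using S' by (intro exI[of _ "insert 0 S'"]) (auto simp: fubini_poly_Suc simp del: mult_pCons_left)
qed

text \<open>If \<open>a\<close> were a multiple root, the cofactor \<open>g\<close> would have the
  same roots as \<open>p\<close> but smaller degree.\<close>

lemma card_roots_eq_degree_imp_simple:
  fixes p :: "real poly"
  assumes "p \<noteq> 0" "card {x. poly p x = 0} = degree p" "poly p a = 0"
  shows "poly (pderiv p) a \<noteq> 0"
proof
  assume d: "poly (pderiv p) a = 0"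
  obtain g where p: "p = [:-a, 1:] * g"
    using assms(3) by (metis poly_eq_0_iff_dvd dvdE)
  have "poly g a = 0" using d unfolding p pderiv_linear_mult by simp
  then have "{x. poly p x = 0} = {x. poly g x = 0}"
    unfolding p by auto
  moreover have "g \<noteq> 0" using p assms(1) by auto
  ultimately have "card {x. poly p x = 0} \<le> degree g"
    using card_poly_roots_bound[of g] by simp
  moreover have "degree p = Suc (degree g)"
    unfolding p using \<open>g \<noteq> 0\<close> by (subst degree_mult_eq) auto
  ultimately show False using assms(2) by simp
qed

text \<open>\<open>fubini_poly n\<close> has as many distinct zeros as its degree, so it is
  real-rooted with simple zeros; the multiplier sequence carries both properties over.\<close>

lemma stirling_poly_simple_roots:
  assumes lam: "multiplier_sequence lam" "\<And>n. lam n > 0" and n: "n \<ge> 1"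
  shows "card {x. poly (stirling_poly lam n) x = 0} = n"
    and "poly (stirling_poly lam n) x = 0 \<Longrightarrow> poly (pderiv (stirling_poly lam n)) x \<noteq> 0"
proof -
  let ?F = "fubini_poly n"
  have dF: "degree ?F = n" by (simp add: degree_stirling_poly)
  then have F0: "?F \<noteq> 0" using n by auto
  obtain S where S: "card S = n" "\<forall>x\<in>S. poly ?F x = 0"
    using fubini_poly_roots[OF n] by blast
  have "n \<le> card {x. poly ?F x = 0}"
    using S card_mono[OF poly_roots_finite[OF F0], of S] by auto
  then have card: "card {x. poly ?F x = 0} = degree ?F"
    using card_poly_roots_bound[OF F0] dF by simp
  have dP: "degree (stirling_poly lam n) = n"
    using lam(2)[of n] by (simp add: degree_stirling_poly)
  have simple: "poly (pderiv (stirling_poly lam n)) x \<noteq> 0"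
    if "poly (stirling_poly lam n) x = 0" for x
    using that multiplier_sequence_simple_roots[OF lam, of ?F x] card dF n
      card_roots_eq_degree_imp_simple[OF F0 card]
    unfolding stirling_poly_eq_diag_op[of lam] by simp
  then show "poly (stirling_poly lam n) x = 0 \<Longrightarrow> poly (pderiv (stirling_poly lam n)) x \<noteq> 0" .
  have "real_rooted ?F" using F0 card by (intro real_rooted_if_card_roots) auto
  then have "real_rooted (stirling_poly lam n)"
    using lam(1) unfolding stirling_poly_eq_diag_op[of lam] multiplier_sequence_def by blast
  then show "card {x. poly (stirling_poly lam n) x = 0} = n"
    using simple dP card_roots_simple_real_rooted by metis
qed

text \<open>The coefficients are nonnegative with a positive leading one, which rules out positive
  zeros; 0 is a zero because \<open>Stirling n 0 = 0\<close> for \<open>n \<ge> 1\<close>.\<close>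

lemma stirling_poly_roots:
  assumes lam: "\<And>n. lam n > 0" and n: "n \<ge> 1"
  shows "poly (stirling_poly lam n) 0 = 0"
    and "{x. poly (stirling_poly lam n) x = 0} = insert 0 (neg_zeros (stirling_poly lam n))"
proof -
  let ?p = "stirling_poly lam n"
  have dp: "degree ?p = n"
    using lam[of n] by (simp add: degree_stirling_poly)
  show 0: "poly ?p 0 = 0"
    using n by (cases n) (simp_all add: poly_0_coeff_0 coeff_stirling_poly)
  have "poly ?p x > 0" if "x > 0" for x
  proof -
    have "0 < (\<Sum>j\<le>n. coeff ?p j * x ^ j)"
      using that lam less_imp_le[OF lam]
      by (intro sum_pos2[of _ n]) (auto simp: coeff_stirling_poly)
    then show ?thesis by (simp add: poly_altdef dp)
  qed
  then show "{x. poly ?p x = 0} = insert 0 (neg_zeros ?p)"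
    using 0 unfolding neg_zeros_def by (force simp: not_less_iff_gr_or_eq)
qed

lemma stirling_poly_neg_zeros:
  assumes lam: "multiplier_sequence lam" "\<And>n. lam n > 0" and n: "n \<ge> 1"
  shows "finite (neg_zeros (stirling_poly lam n))"
    and "card (neg_zeros (stirling_poly lam n)) = n - 1"
    and "x \<in> neg_zeros (stirling_poly lam n) \<Longrightarrow> order x (stirling_poly lam n) = 1"
proof -
  let ?p = "stirling_poly lam n"
  have p0: "?p \<noteq> 0"
    using degree_stirling_poly[of lam n] lam(2)[of n] n by auto
  note roots = stirling_poly_roots(2)[OF lam(2) n]
  show fin: "finite (neg_zeros ?p)"
    using poly_roots_finite[OF p0] unfolding roots by simp
  have "0 \<notin> neg_zeros ?p" by (simp add: neg_zeros_def)
  then show "card (neg_zeros ?p) = n - 1"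
    using stirling_poly_simple_roots(1)[OF lam n] fin unfolding roots by simp
  have "rsquarefree ?p"
    using stirling_poly_simple_roots(2)[OF lam n] by (auto simp: rsquarefree_roots)
  then show "order x ?p = 1" if "x \<in> neg_zeros ?p"
    using that p0 by (simp add: rsquarefree_root_order neg_zeros_def)
qed

section \<open>Scaling limits\<close>

text \<open>The inclusion-exclusion count of surjections from \<open>n\<close> points onto
  \<open>j\<close> points.\<close>

lemma fact_Stirling:
  "fact j * real (Stirling n j) = (\<Sum>i\<le>j. (-1) ^ (j - i) * real (j choose i) * real i ^ n)"
  unfolding Stirling_explicit sum_distrib_left
  by (intro sum.cong) (simp_all add: binomial_fact mult_ac)

text \<open>Signs are dropped and \<open>i ^ n\<close> is replaced by \<open>j ^ n\<close>. The
  bound is uniform in \<open>j\<close> and \<open>n\<close>, as the tail estimates need; the crude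
  factor \<open>2 ^ j\<close> is harmless there.\<close>

lemma fact_Stirling_le: "fact j * real (Stirling n j) \<le> 2 ^ j * real j ^ n"
proof -
  have "fact j * real (Stirling n j) \<le> (\<Sum>i\<le>j. real (j choose i) * real j ^ n)"
    unfolding fact_Stirling
  proof (rule sum_mono)
    fix i assume "i \<in> {..j}"
    then have "real i ^ n \<le> real j ^ n" by (intro power_mono) auto
    moreover have "(-1) ^ (j - i) * real (j choose i) \<le> real (j choose i)"
      by (cases "even (j - i)") auto
    ultimately show "(-1) ^ (j - i) * real (j choose i) * real i ^ n \<le> real (j choose i) * real j ^ n"
      by (intro mult_mono) auto
  qed
  also have "\<dots> = real (\<Sum>i\<le>j. j choose i) * real j ^ n"
    by (simp add: sum_distrib_right)
  finally show ?thesis by (simp add: choose_row_sum)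
qed

text \<open>For fixed \<open>j\<close> the term \<open>i = j\<close> dominates the
  inclusion-exclusion sum.\<close>

lemma fact_Stirling_asymp:
  assumes "j \<ge> 1"
  shows "(\<lambda>n. fact j * real (Stirling n j) / real j ^ n) \<longlonglongrightarrow> 1"
proof -
  have "(\<lambda>n. \<Sum>i\<le>j. (-1) ^ (j - i) * real (j choose i) * (real i / real j) ^ n)
      \<longlonglongrightarrow> (\<Sum>i\<le>j. if i = j then 1 else 0)"
  proof (intro tendsto_sum)
    fix i assume i: "i \<in> {..j}"
    show "(\<lambda>n. (-1) ^ (j - i) * real (j choose i) * (real i / real j) ^ n)
        \<longlonglongrightarrow> (if i = j then 1 else 0)"
    proof (cases "i = j")
      case False
      then have "(\<lambda>n. (real i / real j) ^ n) \<longlonglongrightarrow> 0"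
        using i assms by (intro LIMSEQ_power_zero) auto
      then show ?thesis using False tendsto_mult_right_zero by auto
    qed (use assms in simp)
  qed
  then show ?thesis
    by (simp add: fact_Stirling sum_divide_distrib power_divide)
qed

section \<open>The scale of the zeros and the terms that are negligible on it\<close>

text \<open>The predicted absolute value of the \<open>m\<close>-th negative zero: the point where
  \<open>lam m * m ^ n * s ^ m\<close> equals the same expression for \<open>m + 1\<close>. For
  \<open>m = 0\<close> and \<open>n \<ge> 1\<close> it is 0, which starts the later induction on
  \<open>m\<close>.\<close>

definition zero_scale :: "(nat \<Rightarrow> real) \<Rightarrow> nat \<Rightarrow> nat \<Rightarrow> real" where
  "zero_scale lam m n = lam m / lam (Suc m) * (real m / real (Suc m)) ^ n"

lemma zero_scale_nonneg:
  assumes "\<And>n. lam n > 0"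
  shows "zero_scale lam m n \<ge> 0"
  using less_imp_le[OF assms] by (simp add: zero_scale_def)

lemma zero_scale_pos:
  assumes "\<And>n. lam n > 0" "m \<ge> 1"
  shows "zero_scale lam m n > 0"
  using assms by (simp add: zero_scale_def)

lemma half_powers_sum_le:
  assumes "finite A"
  shows "(\<Sum>j\<in>A. (1/2::real) ^ j) \<le> 2"
proof -
  have "(\<Sum>j\<in>A. (1/2::real) ^ j) \<le> (\<Sum>j. (1/2) ^ j)"
    using assms by (intro sum_le_suminf summable_geometric) auto
  then show ?thesis by (simp add: suminf_geometric)
qed

text \<open>With \<open>j = m + 1 + r\<close>, Bernoulli's inequality gives \<open>j / (m + 1) \<le> ((m + 2) / (m + 1)) ^ r\<close>;
  log-concavity controls \<open>lam j\<close> by a geometric sequence.\<close>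

lemma stirling_tail_term_le:
  fixes lam :: "nat \<Rightarrow> real" and m :: nat
  assumes pos: "\<And>n. lam n > 0"
    and conc: "\<And>k. lam k * lam (k + 2) \<le> (lam (k + 1))\<^sup>2"
    and B: "B \<ge> 0"
  defines "th \<equiv> real m * real (m + 2) / (real (Suc m))\<^sup>2"
  shows "2 ^ (Suc m + r) * coeff (stirling_poly lam n) (Suc m + r) * (B * zero_scale lam m n) ^ r
    \<le> lam (Suc m) * real (Suc m) ^ n * (4 ^ Suc m * (4 * B * th ^ n) ^ r)"
proof -
  let ?j = "Suc m + r" and ?q = "lam (Suc m) / lam m" and ?a = "real (m + 2) / real (Suc m)"
  have q: "?q > 0" using pos by simp
  have "lam (m + Suc r) \<le> lam m * ?q ^ Suc r"
    using pos conc by (rule log_concave_le_geometric)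
  also have "lam m * ?q ^ Suc r = lam (Suc m) * ?q ^ r" using pos[of m] by simp
  finally have 1: "lam ?j \<le> lam (Suc m) * ?q ^ r" by simp
  have "real ?j / real (Suc m) = 1 + real r * (1 / real (Suc m))" by (simp add: field_simps)
  also have "\<dots> \<le> (1 + 1 / real (Suc m)) ^ r"
    by (rule Bernoulli_inequality) (simp add: field_simps)
  also have "1 + 1 / real (Suc m) = ?a" by (simp add: field_simps)
  finally have "real ?j \<le> real (Suc m) * ?a ^ r" by (simp add: field_simps)
  then have "real ?j ^ n \<le> (real (Suc m) * ?a ^ r) ^ n" by (intro power_mono) auto
  with fact_Stirling_le[of ?j n]
  have 2: "fact ?j * real (Stirling n ?j) \<le> 2 ^ ?j * (real (Suc m) * ?a ^ r) ^ n"
    by (rule order_trans[OF _ mult_left_mono]) simp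
  have "coeff (stirling_poly lam n) ?j = lam ?j * (fact ?j * real (Stirling n ?j))"
    by (simp only: coeff_stirling_poly mult.assoc)
  also have "\<dots> \<le> (lam (Suc m) * ?q ^ r) * (2 ^ ?j * (real (Suc m) * ?a ^ r) ^ n)"
    using q pos[of "Suc m"] by (intro mult_mono[OF 1 2]) auto
  finally have "coeff (stirling_poly lam n) ?j
      \<le> (lam (Suc m) * ?q ^ r) * (2 ^ ?j * (real (Suc m) * ?a ^ r) ^ n)" .
  then have "2 ^ ?j * coeff (stirling_poly lam n) ?j * (B * zero_scale lam m n) ^ r
     \<le> 2 ^ ?j * ((lam (Suc m) * ?q ^ r) * (2 ^ ?j * (real (Suc m) * ?a ^ r) ^ n)) * (B * zero_scale lam m n) ^ r"
    using B zero_scale_nonneg[of lam, OF pos] by (intro mult_right_mono mult_left_mono) auto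
  also have "\<dots> = lam (Suc m) * real (Suc m) ^ n * (4 ^ ?j * B ^ r * (?q * zero_scale lam m n * ?a ^ n) ^ r)"
  proof -
    \<comment> \<open>One factor \<open>2 ^ ?j\<close> is part of the statement, the other comes
      from the Stirling bound.\<close>
    have 4: "(2::real) ^ ?j * 2 ^ ?j = 4 ^ ?j" by (simp flip: power_mult_distrib)
    have a: "(?a ^ r) ^ n = (?a ^ n) ^ r" by (simp only: power_mult[symmetric] mult.commute)
    show ?thesis
      unfolding 4[symmetric] power_mult_distrib a by (simp only: mult_ac)
  qed
  \<comment> \<open>The growth of \<open>lam\<close> cancels the quotient of multipliers in the
    scale; the remaining powers combine to \<open>th ^ n\<close>.\<close>
  also have "?q * zero_scale lam m n = (real m / real (Suc m)) ^ n"
    using pos[of m] pos[of "Suc m"] by (simp add: zero_scale_def)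
  also have "(real m / real (Suc m)) ^ n * ?a ^ n = th ^ n"
    by (simp add: th_def power2_eq_square flip: power_mult_distrib)
  finally show ?thesis by (simp add: power_add power_mult_distrib mult_ac)
qed

text \<open>\<open>m (m + 2) = (m + 1)^2 - 1\<close>. The quotient compares the geometric ratios of
  two consecutive scales.\<close>

lemma scale_ratio_less_1: "real m * real (m + 2) / (real (Suc m))\<^sup>2 < 1"
proof -
  have "real m * real (m + 2) < (real (Suc m))\<^sup>2"
    by (simp add: power2_eq_square algebra_simps)
  then show ?thesis by (simp add: divide_less_eq_1)
qed

text \<open>Stated so as to serve two purposes. The factor \<open>2 ^ j\<close> absorbs the binomial
  coefficients of a derivative of order \<open>m + 1\<close>, and the exponent
  \<open>j - Suc m\<close> is what that derivative leaves; for the polynomial itself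
  \<open>2 ^ j\<close> is only an overestimate.\<close>

lemma stirling_tail_tendsto_0:
  fixes lam :: "nat \<Rightarrow> real"
  assumes pos: "\<And>n. lam n > 0"
    and conc: "\<And>k. lam k * lam (k + 2) \<le> (lam (k + 1))\<^sup>2"
    and B: "B \<ge> 0"
  shows "(\<lambda>n. (\<Sum>j=m+2..n. 2 ^ j * coeff (stirling_poly lam n) j * (B * zero_scale lam m n) ^ (j - Suc m))
      / (lam (Suc m) * real (Suc m) ^ n)) \<longlonglongrightarrow> 0"
    (is "?f \<longlonglongrightarrow> 0")
proof -
  define th where "th = real m * real (m + 2) / (real (Suc m))\<^sup>2"
  define u where "u = (\<lambda>n. 4 * B * th ^ n)"
  have th: "0 \<le> th" "th < 1"
    using scale_ratio_less_1 by (auto simp: th_def)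
  have u0: "u n \<ge> 0" for n using B th by (simp add: u_def)
  have "(\<lambda>n. th ^ n) \<longlonglongrightarrow> 0" using th by (intro LIMSEQ_power_zero) auto
  then have u_lim: "u \<longlonglongrightarrow> 0" unfolding u_def by (rule tendsto_mult_right_zero)
  have nonneg: "?f n \<ge> 0" for n
    using B zero_scale_nonneg[of lam, OF pos] less_imp_le[OF pos]
    by (intro divide_nonneg_nonneg sum_nonneg mult_nonneg_nonneg zero_le_power)
      (auto simp: coeff_stirling_poly)
  have "eventually (\<lambda>n. u n < 1 / 2) sequentially"
    using u_lim by (rule order_tendstoD) simp
  \<comment> \<open>The factor \<open>2 ^ (m + 3)\<close> consists of \<open>2 ^ (m + 2)\<close>
    from rewriting \<open>(1/2) ^ r\<close> in terms of \<open>j\<close>, and of 2 from the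
    geometric sum.\<close>
  then have upper: "eventually (\<lambda>n. ?f n \<le> 4 ^ Suc m * 2 ^ (m + 3) * u n) sequentially"
  proof eventually_elim
    case (elim n)
    let ?L = "lam (Suc m) * real (Suc m) ^ n"
    have L: "?L > 0" using pos by simp
    have "(\<Sum>j=m+2..n. 2 ^ j * coeff (stirling_poly lam n) j * (B * zero_scale lam m n) ^ (j - Suc m))
      \<le> (\<Sum>j=m+2..n. ?L * (4 ^ Suc m * 2 ^ (m + 2) * u n) * (1/2) ^ j)"
    proof (rule sum_mono)
      fix j assume j: "j \<in> {m+2..n}"
      \<comment> \<open>The offset \<open>m + 2\<close> leaves the power \<open>u n ^ Suc r\<close>:
        one factor \<open>u n\<close> is kept to force the limit 0, the others are bounded by
        1/2.\<close>
      define r where "r = j - (m + 2)"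
      have jr: "j = Suc m + Suc r" using j by (auto simp: r_def)
      have "2 ^ j * coeff (stirling_poly lam n) j * (B * zero_scale lam m n) ^ (j - Suc m)
          \<le> ?L * (4 ^ Suc m * u n ^ Suc r)"
        using stirling_tail_term_le[of lam B m "Suc r" n, OF pos conc B]
        unfolding jr u_def th_def by simp
      also have "\<dots> \<le> ?L * (4 ^ Suc m * (u n * (1/2) ^ r))"
        using elim u0[of n] L
        by (simp only: power_Suc) (intro mult_left_mono power_mono; simp)
      also have "(1/2::real) ^ r = 2 ^ (m + 2) * (1/2) ^ j"
        unfolding jr by (simp add: power_add field_simps)
      also have "?L * (4 ^ Suc m * (u n * (2 ^ (m + 2) * (1/2) ^ j)))
          = ?L * (4 ^ Suc m * 2 ^ (m + 2) * u n) * (1/2) ^ j"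
        by (simp only: mult_ac)
      finally show "2 ^ j * coeff (stirling_poly lam n) j * (B * zero_scale lam m n) ^ (j - Suc m)
          \<le> ?L * (4 ^ Suc m * 2 ^ (m + 2) * u n) * (1/2) ^ j" .
    qed
    also have "\<dots> = ?L * (4 ^ Suc m * 2 ^ (m + 2) * u n) * (\<Sum>j=m+2..n. (1/2) ^ j)"
      by (simp add: sum_distrib_left)
    also have "\<dots> \<le> ?L * (4 ^ Suc m * 2 ^ (m + 2) * u n) * 2"
      using u0[of n] L half_powers_sum_le[of "{m+2..n}"]
      by (intro mult_left_mono) (auto simp: less_imp_le)
    also have "\<dots> = ?L * (4 ^ Suc m * 2 ^ (m + 3) * u n)"
      by (simp add: power_add)
    finally show ?case
      using L by (simp add: divide_le_eq mult.commute)
  qed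
  have "(\<lambda>n. 4 ^ Suc m * 2 ^ (m + 3) * u n) \<longlonglongrightarrow> 0"
    using u_lim by (rule tendsto_mult_right_zero)
  then show ?thesis
    by (rule tendsto_sandwich[OF always_eventually[OF allI[OF nonneg]] upper tendsto_const])
qed

text \<open>Either side may therefore serve as the common normalisation of the terms
  \<open>m\<close> and \<open>m + 1\<close>.\<close>

lemma zero_scale_balance:
  assumes pos: "\<And>n. lam n > 0" and m: "m \<ge> 1"
  shows "lam (Suc m) * real (Suc m) ^ n * zero_scale lam m n ^ Suc m
    = lam m * real m ^ n * zero_scale lam m n ^ m"
  using pos[of "Suc m"] m by (simp add: zero_scale_def power_divide)

text \<open>The quotient is at most a constant times \<open>ph ^ n\<close>, where \<open>ph\<close>
  combines \<open>j / m\<close> with the \<open>m - j\<close> missing powers of the scale.\<close>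

lemma stirling_low_term_tendsto_0:
  fixes lam :: "nat \<Rightarrow> real"
  assumes pos: "\<And>n. lam n > 0" and j: "j < m"
  shows "(\<lambda>n. coeff (stirling_poly lam n) j * zero_scale lam m n ^ j
    / (lam m * real m ^ n * zero_scale lam m n ^ m)) \<longlonglongrightarrow> 0"
    (is "?f \<longlonglongrightarrow> 0")
proof -
  define k where "k = m - j"
  have mk: "m = j + k" "k \<ge> 1" using j by (auto simp: k_def)
  have m1: "m \<ge> 1" using j by simp
  define ph where "ph = real j / real m * (real (Suc m) / real m) ^ k"
  define C where "C = lam j * 2 ^ j / lam m * (lam (Suc m) / lam m) ^ k"
  \<comment> \<open>Bernoulli's inequality gives \<open>j / m \<le> (1 - 1 / m) ^ k\<close>, and
    \<open>(1 - 1 / m) (1 + 1 / m) < 1\<close>.\<close>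
  have "real j / real m = 1 + real k * (- (1 / real m))"
    using mk j by (simp add: field_simps)
  also have "\<dots> \<le> (1 + - (1 / real m)) ^ k"
    using m1 by (intro Bernoulli_inequality) (simp add: field_simps)
  finally have "ph \<le> (1 + - (1 / real m)) ^ k * (real (Suc m) / real m) ^ k"
    unfolding ph_def by (intro mult_right_mono) auto
  also have "\<dots> = (1 - 1 / (real m)\<^sup>2) ^ k"
    unfolding power_mult_distrib[symmetric] using m1
    by (intro arg_cong[of _ _ "\<lambda>x. x ^ k"]) (simp add: field_simps power2_eq_square)
  also have "\<dots> < 1"
    using m1 mk by (intro power_less_one_iff[THEN iffD2]) (auto simp: field_simps)
  finally have ph: "ph < 1" "ph \<ge> 0" by (simp_all add: ph_def)
  then have lim: "(\<lambda>n. C * ph ^ n) \<longlonglongrightarrow> 0"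
    by (intro tendsto_mult_right_zero LIMSEQ_power_zero) auto
  have nonneg: "?f n \<ge> 0" for n
    using zero_scale_nonneg[of lam, OF pos] less_imp_le[OF pos] by (simp add: coeff_stirling_poly)
  have upper: "?f n \<le> C * ph ^ n" for n
  proof -
    let ?s = "zero_scale lam m n"
    have s: "?s > 0" using pos m1 by (rule zero_scale_pos)
    have inv: "inverse ?s = lam (Suc m) / lam m * (real (Suc m) / real m) ^ n"
      by (simp add: zero_scale_def power_divide)
    have "?f n = lam j * (fact j * real (Stirling n j)) / (lam m * real m ^ n) * inverse ?s ^ k"
      using s unfolding coeff_stirling_poly mk(1)[symmetric]
      by (subst (3) mk(1)) (simp add: power_add field_simps)
    also have "\<dots> \<le> lam j * (2 ^ j * real j ^ n) / (lam m * real m ^ n) * inverse ?s ^ k"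
      using s pos[of m] pos[of j] fact_Stirling_le[of j n]
      by (intro mult_right_mono divide_right_mono mult_left_mono) auto
    also have "\<dots> = C * ph ^ n"
      unfolding inv C_def ph_def
      by (simp add: power_mult_distrib power_divide power_mult[symmetric] mult_ac)
    finally show ?thesis .
  qed
  show ?thesis
    by (rule tendsto_sandwich[OF always_eventually[OF allI[OF nonneg]]
        always_eventually[OF allI[OF upper]] tendsto_const lim])
qed

text \<open>After normalisation the terms \<open>m\<close> and \<open>m + 1\<close> tend to
  \<open>(- y) ^ m\<close> and \<open>(- y) ^ Suc m\<close>, while all terms below and the whole
  tail above vanish.\<close>

lemma stirling_poly_scaled_tendsto:
  fixes lam :: "nat \<Rightarrow> real"
  assumes pos: "\<And>n. lam n > 0"
    and conc: "\<And>k. lam k * lam (k + 2) \<le> (lam (k + 1))\<^sup>2"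
    and m: "m \<ge> 1" and y: "y > 0"
  shows "(\<lambda>n. poly (stirling_poly lam n) (- (y * zero_scale lam m n))
      / (lam m * real m ^ n * zero_scale lam m n ^ m)) \<longlonglongrightarrow> (- y) ^ m * (1 - y)"
proof -
  let ?s = "zero_scale lam m" and ?c = "\<lambda>n. coeff (stirling_poly lam n)"
  define K where "K = (\<lambda>n. lam m * real m ^ n * ?s n ^ m)"
  have s: "?s n > 0" for n using pos m by (rule zero_scale_pos)
  have K: "K n > 0" for n using pos[of m] s m by (simp add: K_def)
  have K': "K n = lam (Suc m) * real (Suc m) ^ n * ?s n ^ Suc m" for n
    unfolding K_def by (rule zero_scale_balance[of lam, OF pos m, symmetric])
  define t where "t = (\<lambda>n j. ?c n j * (- (y * ?s n)) ^ j / K n)"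
  have "(\<lambda>n. \<Sum>j\<le>Suc m. t n j)
      \<longlonglongrightarrow> (\<Sum>j\<le>Suc m. if j < m then 0 else (- y) ^ j)"
  proof (intro tendsto_sum)
    fix j assume j: "j \<in> {..Suc m}"
    have t: "t n j = (- y) ^ j * (?c n j * ?s n ^ j / K n)" for n
      by (simp add: t_def power_mult_distrib minus_mult_left del: mult_minus_left)
    consider "j < m" | "j = m" | "j = Suc m" using j by fastforce
    then show "(\<lambda>n. t n j) \<longlonglongrightarrow> (if j < m then 0 else (- y) ^ j)"
    proof cases
      case 1
      then show ?thesis
        unfolding t K_def
        using tendsto_mult_right_zero[OF stirling_low_term_tendsto_0[of lam, OF pos 1], of "(- y) ^ j"]
        by (simp only: if_True)
    next
      case 2
      have "?c n j * ?s n ^ j / K n = fact m * real (Stirling n m) / real m ^ n" for n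
        using pos[of m] s[of n] 2 by (simp add: K_def coeff_stirling_poly)
      then show ?thesis
        unfolding t using tendsto_mult[OF tendsto_const fact_Stirling_asymp[OF m], of "(- y) ^ m"] 2
        by simp
    next
      case 3
      have "?c n j * ?s n ^ j / K n = fact (Suc m) * real (Stirling n (Suc m)) / real (Suc m) ^ n" for n
        using pos[of "Suc m"] s[of n] 3
        by (simp add: K' coeff_stirling_poly del: fact_Suc of_nat_Suc)
      then show ?thesis
        unfolding t
        using tendsto_mult[OF tendsto_const fact_Stirling_asymp[of "Suc m"], of "(- y) ^ Suc m"] 3
        by (simp del: fact_Suc of_nat_Suc)
    qed
  qed
  also have "(\<Sum>j\<le>Suc m. if j < m then 0 else (- y) ^ j) = (- y) ^ m * (1 - y)"
  proof -
    have "(\<Sum>j<m. if j < m then 0 else (- y) ^ j) = 0" by (intro sum.neutral) auto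
    then show ?thesis by (simp add: lessThan_Suc_atMost[symmetric] algebra_simps)
  qed
  finally have head: "(\<lambda>n. \<Sum>j\<le>Suc m. t n j) \<longlonglongrightarrow> (- y) ^ m * (1 - y)" .
  define T where "T = (\<lambda>n. (\<Sum>j=m+2..n. 2 ^ j * ?c n j * (y * ?s n) ^ (j - Suc m))
      / (lam (Suc m) * real (Suc m) ^ n))"
  have "T \<longlonglongrightarrow> 0"
    unfolding T_def using y by (intro stirling_tail_tendsto_0 pos conc) simp
  then have T: "(\<lambda>n. y ^ Suc m * T n) \<longlonglongrightarrow> 0"
    by (rule tendsto_mult_right_zero)
  have "norm (\<Sum>j=m+2..n. t n j) \<le> y ^ Suc m * T n" for n
  proof -
    let ?L = "lam (Suc m) * real (Suc m) ^ n"
    have "norm (\<Sum>j=m+2..n. t n j)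
        \<le> (\<Sum>j=m+2..n. y ^ Suc m * (2 ^ j * ?c n j * (y * ?s n) ^ (j - Suc m) / ?L))"
    proof (rule sum_norm_le)
      fix j assume "j \<in> {m+2..n}"
      then obtain r where j: "j = Suc m + r" by (auto simp: le_iff_add)
      have c: "?c n j \<ge> 0" using less_imp_le[OF pos] by (simp add: coeff_stirling_poly)
      have "norm (t n j) = ?c n j * (y * ?s n) ^ j / K n"
        using c y s[of n] K[of n] by (simp add: t_def abs_mult power_abs)
      \<comment> \<open>The power \<open>?s n ^ Suc m\<close> cancels against \<open>K'\<close>; the
        leading 1 is then enlarged to \<open>2 ^ j\<close> to match the tail estimate.\<close>
      also have "\<dots> = 1 * (y ^ Suc m * (?c n j * (y * ?s n) ^ (j - Suc m) / ?L))"
        using s[of n] unfolding K' j by (simp add: power_add power_mult_distrib del: of_nat_Suc)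
      also have "\<dots> \<le> 2 ^ j * (y ^ Suc m * (?c n j * (y * ?s n) ^ (j - Suc m) / ?L))"
        using c y s[of n] pos[of "Suc m"] by (intro mult_right_mono) auto
      finally show "norm (t n j) \<le> y ^ Suc m * (2 ^ j * ?c n j * (y * ?s n) ^ (j - Suc m) / ?L)"
        by (simp add: mult_ac)
    qed
    then show ?thesis by (simp add: T_def sum_distrib_left sum_divide_distrib)
  qed
  then have tail: "(\<lambda>n. \<Sum>j=m+2..n. t n j) \<longlonglongrightarrow> 0"
    by (intro tendsto_0_le[OF T, of _ 1] always_eventually allI)
      (metis abs_ge_self mult.right_neutral order_trans real_norm_def)
  have "eventually (\<lambda>n. (\<Sum>j\<le>Suc m. t n j) + (\<Sum>j=m+2..n. t n j)
      = poly (stirling_poly lam n) (- (y * ?s n)) / K n) sequentially"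
    using eventually_ge_at_top[of "Suc m"]
  proof eventually_elim
    case (elim n)
    have dp: "degree (stirling_poly lam n) = n"
      using pos[of n] by (simp add: degree_stirling_poly)
    have "{..n} = {..Suc m} \<union> {m+2..n}" using elim by auto
    moreover have "{..Suc m} \<inter> {m+2..n} = {}" by auto
    ultimately have "(\<Sum>j\<le>n. t n j) = (\<Sum>j\<le>Suc m. t n j) + (\<Sum>j=m+2..n. t n j)"
      by (metis finite_atMost finite_atLeastAtMost sum.union_disjoint)
    then show ?case by (simp add: poly_altdef dp t_def sum_divide_distrib)
  qed
  moreover have "(\<lambda>n. (\<Sum>j\<le>Suc m. t n j) + (\<Sum>j=m+2..n. t n j)) \<longlonglongrightarrow> (- y) ^ m * (1 - y)"
    using tendsto_add[OF head tail] by simp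
  ultimately show ?thesis
    unfolding K_def by (rule Lim_transform_eventually[rotated])
qed

section \<open>Location of the zeros\<close>

text \<open>The limit \<open>(- y) ^ m * (1 - y)\<close> changes sign at \<open>y = 1\<close>.
  Taking the product of the values at \<open>1 + e\<close> and \<open>1 - e\<close> treats both
  parities of \<open>m\<close> at once.\<close>

lemma eventually_neg_zero_near_scale:
  fixes lam :: "nat \<Rightarrow> real"
  assumes pos: "\<And>n. lam n > 0"
    and conc: "\<And>k. lam k * lam (k + 2) \<le> (lam (k + 1))\<^sup>2"
    and m: "m \<ge> 1" and e: "0 < e" "e < 1"
  shows "eventually (\<lambda>n. \<exists>z\<in>neg_zeros (stirling_poly lam n).
    - ((1 + e) * zero_scale lam m n) < z \<and> z < - ((1 - e) * zero_scale lam m n)) sequentially"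
proof -
  let ?s = "zero_scale lam m"
  define K where "K = (\<lambda>n. lam m * real m ^ n * ?s n ^ m)"
  let ?P = "\<lambda>y n. poly (stirling_poly lam n) (- (y * ?s n))"
  have s: "?s n > 0" for n using pos m by (rule zero_scale_pos)
  have K: "K n > 0" for n using pos[of m] s m by (simp add: K_def)
  have lim: "(\<lambda>n. ?P y n / K n) \<longlonglongrightarrow> (- y) ^ m * (1 - y)" if "y > 0" for y
    unfolding K_def using pos conc m that by (rule stirling_poly_scaled_tendsto)
  have "(\<lambda>n. ?P (1 + e) n / K n * (?P (1 - e) n / K n))
      \<longlonglongrightarrow> (- (1 + e)) ^ m * (1 - (1 + e)) * ((- (1 - e)) ^ m * (1 - (1 - e)))"
    using e by (intro tendsto_mult lim) auto
  moreover have "(- (1 + e)) ^ m * (1 - (1 + e)) * ((- (1 - e)) ^ m * (1 - (1 - e))) < 0"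
  proof -
    have "(- (1 + e)) ^ m * (1 - (1 + e)) * ((- (1 - e)) ^ m * (1 - (1 - e)))
        = - (((1 + e) * (1 - e)) ^ m * (e * e))"
      by (simp add: power_minus[of "1 + e"] power_minus[of "1 - e"] power_mult_distrib
          del: minus_add_distrib minus_diff_eq)
    moreover have "((1 + e) * (1 - e)) ^ m * (e * e) > 0" using e by simp
    ultimately show ?thesis by linarith
  qed
  ultimately have "eventually (\<lambda>n. ?P (1 + e) n / K n * (?P (1 - e) n / K n) < 0) sequentially"
    by (rule order_tendstoD)
  then show ?thesis
  proof eventually_elim
    case (elim n)
    have "?P (1 + e) n * ?P (1 - e) n < 0"
      using elim K[of n] by (simp add: divide_less_0_iff zero_less_mult_iff mult_less_0_iff)
    moreover have lt: "- ((1 + e) * ?s n) < - ((1 - e) * ?s n)"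
      using s[of n] e by (simp add: algebra_simps)
    ultimately obtain z where z: "- ((1 + e) * ?s n) < z" "z < - ((1 - e) * ?s n)"
        "poly (stirling_poly lam n) z = 0"
      using poly_IVT by blast
    have "(1 - e) * ?s n > 0" using s[of n] e by simp
    then have "z < 0" using z by linarith
    then show ?case using z by (auto simp: neg_zeros_def)
  qed
qed

text \<open>The quotient of consecutive scales is a constant times the \<open>n\<close>-th power of
  a number below 1.\<close>

lemma zero_scale_separation:
  fixes lam :: "nat \<Rightarrow> real"
  assumes pos: "\<And>n. lam n > 0" and c: "c > 0"
  shows "eventually (\<lambda>n. zero_scale lam m n < c * zero_scale lam (Suc m) n) sequentially"
proof -
  let ?th = "real m * real (m + 2) / (real (Suc m))\<^sup>2"
  let ?C = "lam m / lam (Suc m) * (lam (Suc (Suc m)) / lam (Suc m))"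
  have "(\<lambda>n. ?th ^ n) \<longlonglongrightarrow> 0"
    using scale_ratio_less_1[of m] by (intro LIMSEQ_power_zero) auto
  then have "(\<lambda>n. ?C * ?th ^ n) \<longlonglongrightarrow> 0" by (rule tendsto_mult_right_zero)
  then have "eventually (\<lambda>n. ?C * ?th ^ n < c) sequentially"
    using c by (rule order_tendstoD)
  then show ?thesis
  proof eventually_elim
    case (elim n)
    have s: "zero_scale lam (Suc m) n > 0" by (intro zero_scale_pos pos) simp
    have th: "?th = real m / real (Suc m) / (real (Suc m) / real (Suc (Suc m)))"
      by (simp add: power2_eq_square)
    have "zero_scale lam m n / zero_scale lam (Suc m) n = ?C * ?th ^ n"
      unfolding th zero_scale_def power_divide[of _ "real (Suc m) / real (Suc (Suc m))"]
      using pos[of "Suc m"] by (simp add: field_simps del: of_nat_Suc)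
    then have "zero_scale lam m n / zero_scale lam (Suc m) n < c" using elim by (simp only:)
    then show ?case using s by (simp add: divide_less_eq)
  qed
qed

text \<open>By Rolle's theorem one zero too many would give a zero of the derivative of order \<open>m + 1\<close>,
  whose constant term dominates on this interval.\<close>

lemma eventually_card_neg_zeros_le:
  fixes lam :: "nat \<Rightarrow> real"
  assumes mult: "multiplier_sequence lam" and pos: "\<And>n. lam n > 0"
  shows "eventually (\<lambda>n. card {z \<in> neg_zeros (stirling_poly lam n). z > - (2 * zero_scale lam m n)} \<le> m)
    sequentially"
proof -
  let ?s = "zero_scale lam m" and ?c = "\<lambda>n. coeff (stirling_poly lam n)"
  have conc: "lam k * lam (k + 2) \<le> (lam (k + 1))\<^sup>2" for k
    using mult pos by (rule multiplier_sequence_log_concave)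
  define L where "L = (\<lambda>n. lam (Suc m) * real (Suc m) ^ n)"
  \<comment> \<open>Bounds the nonconstant part of the derivative of order \<open>m + 1\<close>,
    divided by \<open>fact (Suc m)\<close>, on the interval from \<open>- (2 * ?s n)\<close> to
    0.\<close>
  define T where "T = (\<lambda>n. \<Sum>j=m+2..n. 2 ^ j * ?c n j * (2 * ?s n) ^ (j - Suc m))"
  have L: "L n > 0" for n using pos[of "Suc m"] by (simp add: L_def)
  have "(\<lambda>n. T n / L n) \<longlonglongrightarrow> 0"
    unfolding T_def L_def by (intro stirling_tail_tendsto_0 pos conc) simp
  then have "eventually (\<lambda>n. T n / L n < 1 / 2) sequentially"
    by (rule order_tendstoD) simp
  moreover have "(\<lambda>n. ?c n (Suc m) / L n) \<longlonglongrightarrow> 1"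
    using fact_Stirling_asymp[of "Suc m"] pos[of "Suc m"]
    by (simp add: L_def coeff_stirling_poly mult.assoc del: fact_Suc of_nat_Suc)
  then have "eventually (\<lambda>n. 1 / 2 < ?c n (Suc m) / L n) sequentially"
    by (rule order_tendstoD) simp
  ultimately show ?thesis
    using eventually_ge_at_top[of "Suc m"]
  proof eventually_elim
    case (elim n)
    let ?p = "stirling_poly lam n"
    let ?A = "{z \<in> neg_zeros ?p. z > - (2 * ?s n)}"
    have n: "n \<ge> 1" using elim by simp
    have "T n / L n < ?c n (Suc m) / L n" using elim by linarith
    then have T_less: "T n < ?c n (Suc m)" using L[of n] by (simp add: divide_less_cancel)
    have s: "?s n \<ge> 0" using pos by (rule zero_scale_nonneg)
    have c: "?c n j \<ge> 0" for j using less_imp_le[OF pos] by (simp add: coeff_stirling_poly)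
    show ?case
    proof (rule ccontr)
      assume "\<not> card ?A \<le> m"
      then obtain B where B: "B \<subseteq> ?A" "card B = Suc m" "finite B"
        using obtain_subset_with_card_n[of "Suc m" ?A] by auto
      have "0 \<notin> B" using B by (auto simp: neg_zeros_def)
      \<comment> \<open>With 0 there are \<open>m + 2\<close> zeros, so one survives
        \<open>m + 1\<close> differentiations.\<close>
      then have "card (insert 0 B) = Suc m + Suc 0" using B by simp
      moreover have "insert 0 B \<subseteq> {- (2 * ?s n)..0}"
        using B s by (auto simp: neg_zeros_def subset_iff intro: less_imp_le)
      moreover have "poly ?p x = 0" if "x \<in> insert 0 B" for x
        using that B stirling_poly_roots(1)[OF pos n] by (auto simp: neg_zeros_def)
      ultimately obtain S where "card S = Suc 0" "S \<subseteq> {- (2 * ?s n)..0}"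
          "\<forall>x\<in>S. poly ((pderiv ^^ Suc m) ?p) x = 0"
        using Rolle_card_higher[of "insert 0 B" "Suc m" 0 "- (2 * ?s n)" 0 ?p] B(3) by blast
      then obtain x where x: "- (2 * ?s n) \<le> x" "x \<le> 0" "poly ((pderiv ^^ Suc m) ?p) x = 0"
        by (auto simp: card_Suc_eq)
      define b where "b = (\<lambda>i. real ((i + Suc m) choose Suc m) * ?c n (i + Suc m) * x ^ i)"
      have "degree ((pderiv ^^ Suc m) ?p) = n - Suc m"
        using pos[of n] by (simp add: degree_higher_pderiv degree_stirling_poly del: funpow.simps)
      moreover have "coeff ((pderiv ^^ Suc m) ?p) i
          = fact (Suc m) * (real ((i + Suc m) choose Suc m) * ?c n (i + Suc m))" for i
      proof -
        \<comment> \<open>The Pochhammer factor of repeated differentiation is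
          \<open>fact (Suc m)\<close> times a binomial coefficient, which is later bounded by
          \<open>2 ^ (i + Suc m)\<close>.\<close>
        have arg: "real (i + Suc m) - real (Suc m) + 1 = real (Suc i)" by simp
        have "pochhammer (real (Suc i)) (Suc m) = fact (Suc m) * real ((i + Suc m) choose Suc m)"
          unfolding binomial_gbinomial gbinomial_pochhammer' arg by (simp del: fact_Suc)
        then show ?thesis by (simp only: coeff_higher_pderiv mult.assoc)
      qed
      ultimately have "fact (Suc m) * (\<Sum>i\<le>n - Suc m. b i) = 0"
        using x(3) by (simp add: poly_altdef b_def sum_distrib_left mult.assoc del: fact_Suc funpow.simps)
      then have "0 = (\<Sum>i\<le>n - Suc m. b i)" by (simp del: fact_Suc)
      also have "{..n - Suc m} = insert 0 {1..n - Suc m}" by auto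
      also have "(\<Sum>i\<in>insert 0 {1..n - Suc m}. b i) = ?c n (Suc m) + (\<Sum>i=1..n - Suc m. b i)"
        by (simp add: b_def)
      finally have "?c n (Suc m) = - (\<Sum>i=1..n - Suc m. b i)" by linarith
      also have "\<dots> \<le> norm (\<Sum>i=1..n - Suc m. b i)" by simp
      also have "\<dots> \<le> (\<Sum>i=1..n - Suc m. 2 ^ (i + Suc m) * ?c n (i + Suc m) * (2 * ?s n) ^ i)"
      proof (rule sum_norm_le)
        fix i
        have "real ((i + Suc m) choose Suc m) \<le> 2 ^ (i + Suc m)"
          using binomial_le_pow2[of "i + Suc m" "Suc m"]
          by (metis of_nat_le_iff of_nat_numeral of_nat_power)
        moreover have "\<bar>x\<bar> ^ i \<le> (2 * ?s n) ^ i" using x by (intro power_mono) auto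
        ultimately have "real ((i + Suc m) choose Suc m) * ?c n (i + Suc m) * \<bar>x\<bar> ^ i
            \<le> 2 ^ (i + Suc m) * ?c n (i + Suc m) * (2 * ?s n) ^ i"
          using c[of "i + Suc m"] by (intro mult_mono) auto
        then show "norm (b i) \<le> 2 ^ (i + Suc m) * ?c n (i + Suc m) * (2 * ?s n) ^ i"
          using c[of "i + Suc m"] by (simp add: b_def abs_mult power_abs)
      qed
      also have "\<dots> = (\<Sum>j=1 + Suc m..(n - Suc m) + Suc m. 2 ^ j * ?c n j * (2 * ?s n) ^ (j - Suc m))"
        by (subst sum.shift_bounds_cl_nat_ivl) simp
      also have "\<dots> = T n" using elim by (simp add: T_def)
      finally show False using T_less by simp
    qed
  qed
qed

text \<open>By induction on \<open>m\<close>: the zero located near the scale of index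
  \<open>Suc m\<close> is new compared with the \<open>m\<close> zeros counted before, and the upper
  bound leaves no room for more.\<close>

lemma eventually_card_neg_zeros_eq:
  fixes lam :: "nat \<Rightarrow> real"
  assumes mult: "multiplier_sequence lam" and pos: "\<And>n. lam n > 0"
  shows "eventually (\<lambda>n. card {z \<in> neg_zeros (stirling_poly lam n). z > - (2 * zero_scale lam m n)} = m)
    sequentially"
proof (induction m)
  case 0
  have "eventually (\<lambda>n. n \<ge> (1::nat)) sequentially" by (rule eventually_ge_at_top)
  then show ?case
  proof eventually_elim
    case (elim n)
    then have "zero_scale lam 0 n = 0" by (simp add: zero_scale_def)
    then have "{z \<in> neg_zeros (stirling_poly lam n). z > - (2 * zero_scale lam 0 n)} = {}"
      by (auto simp: neg_zeros_def)
    then show ?case by (simp only: card.empty)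
  qed
next
  case (Suc m)
  let ?A = "\<lambda>m n. {z \<in> neg_zeros (stirling_poly lam n). z > - (2 * zero_scale lam m n)}"
  have conc: "lam k * lam (k + 2) \<le> (lam (k + 1))\<^sup>2" for k
    using mult pos by (rule multiplier_sequence_log_concave)
  \<comment> \<open>With 1/4 here and tolerance 1/2 below, the located zero lies beyond twice the
    old scale but within twice the new one.\<close>
  have "eventually (\<lambda>n. zero_scale lam m n < (1/4) * zero_scale lam (Suc m) n) sequentially"
    using pos by (rule zero_scale_separation) simp
  moreover have "eventually (\<lambda>n. \<exists>z\<in>neg_zeros (stirling_poly lam n).
      - ((1 + 1/2) * zero_scale lam (Suc m) n) < z \<and> z < - ((1 - 1/2) * zero_scale lam (Suc m) n)) sequentially"
    using pos conc by (rule eventually_neg_zero_near_scale) auto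
  moreover have "eventually (\<lambda>n. card (?A (Suc m) n) \<le> Suc m) sequentially"
    using mult pos by (rule eventually_card_neg_zeros_le)
  ultimately show ?case
    using Suc.IH eventually_ge_at_top[of 1]
  proof eventually_elim
    case (elim n)
    have fin: "finite (?A k n)" for k
      using stirling_poly_neg_zeros(1)[OF mult pos elim(5)] by simp
    have s: "zero_scale lam (Suc m) n \<ge> 0" using pos by (rule zero_scale_nonneg)
    from elim(2) obtain z where z: "z \<in> neg_zeros (stirling_poly lam n)"
      "- ((1 + 1/2) * zero_scale lam (Suc m) n) < z" "z < - ((1 - 1/2) * zero_scale lam (Suc m) n)"
      by blast
    have "z \<notin> ?A m n" using z elim(1) by auto
    moreover have "insert z (?A m n) \<subseteq> ?A (Suc m) n"
      using z elim(1) s by auto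
    ultimately have "Suc m \<le> card (?A (Suc m) n)"
      using card_mono[OF fin, of "insert z (?A m n)" "Suc m"] fin[of m] elim(4) by simp
    then show ?case using elim(3) by simp
  qed
qed

text \<open>Turns zero counts into the list index in \<open>zeta\<close>: in decreasing order, the
  position counted from 0 is the number of larger elements.\<close>

lemma rev_sorted_list_of_set_nth:
  fixes A :: "'a::linorder set"
  assumes "finite A" "z \<in> A" "card {a \<in> A. z < a} = k"
  shows "rev (sorted_list_of_set A) ! k = z"
proof -
  let ?L = "sorted_list_of_set A"
  have L: "set ?L = A" "sorted_wrt (<) ?L" "distinct ?L"
    using assms(1) by (auto simp: strict_sorted_iff)
  then obtain i where i: "i < length ?L" "?L ! i = z"
    using assms(2) by (metis in_set_conv_nth)
  have mono: "?L ! a < ?L ! b \<longleftrightarrow> a < b" if "a < length ?L" "b < length ?L" for a b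
    using L(2) that by (metis not_less_iff_gr_or_eq sorted_wrt_nth_less)
  have "{a \<in> A. z < a} = (!) ?L ` {i<..<length ?L}"
  proof (intro equalityI subsetI)
    fix a assume a: "a \<in> {a \<in> A. z < a}"
    then obtain b where "b < length ?L" "?L ! b = a"
      using L(1) by (metis (no_types, lifting) in_set_conv_nth mem_Collect_eq)
    then show "a \<in> (!) ?L ` {i<..<length ?L}"
      using a i mono[of i b] by auto
  next
    fix a assume "a \<in> (!) ?L ` {i<..<length ?L}"
    then obtain b where "i < b" "b < length ?L" "a = ?L ! b" by auto
    then show "a \<in> {a \<in> A. z < a}"
      using i mono[of i b] nth_mem[of b ?L] L(1) by auto
  qed
  moreover have "inj_on ((!) ?L) {i<..<length ?L}"
    using L(3) by (auto intro: inj_on_nth)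
  ultimately have "k = length ?L - Suc i"
    using assms(3) by (simp add: card_image)
  then show ?thesis using i by (simp add: rev_nth)
qed

text \<open>The located zero has at least \<open>m - 1\<close> negative zeros to its right by the
  count at index \<open>l = m - 1\<close>, and at most that many by the count at index
  \<open>m\<close>; so it is the \<open>m\<close>-th one.\<close>

lemma zeta_div_zero_scale_tendsto:
  fixes lam :: "nat \<Rightarrow> real"
  assumes mult: "multiplier_sequence lam" and pos: "\<And>n. lam n > 0" and "m \<ge> 1"
  shows "(\<lambda>n. zeta lam m n / - zero_scale lam m n) \<longlonglongrightarrow> 1"
proof -
  obtain l where m: "m = Suc l" using \<open>m \<ge> 1\<close> by (cases m) auto
  have conc: "lam k * lam (k + 2) \<le> (lam (k + 1))\<^sup>2" for k
    using mult pos by (rule multiplier_sequence_log_concave)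
  let ?A = "\<lambda>m n. {z \<in> neg_zeros (stirling_poly lam n). z > - (2 * zero_scale lam m n)}"
  have "eventually (\<lambda>n. \<bar>zeta lam m n / - zero_scale lam m n - 1\<bar> < e) sequentially"
    if e: "0 < e" "e < 1" for e
  proof -
    \<comment> \<open>This constant gives
      \<open>2 * zero_scale lam l n < (1 - e) * zero_scale lam m n\<close>, so the located zero lies
      left of every zero counted at index \<open>l\<close>.\<close>
    have "eventually (\<lambda>n. zero_scale lam l n < ((1 - e) / 2) * zero_scale lam m n) sequentially"
      unfolding m using pos by (rule zero_scale_separation) (use e in simp)
    moreover have "eventually (\<lambda>n. \<exists>z\<in>neg_zeros (stirling_poly lam n).
        - ((1 + e) * zero_scale lam m n) < z \<and> z < - ((1 - e) * zero_scale lam m n)) sequentially"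
      using pos conc \<open>m \<ge> 1\<close> e by (rule eventually_neg_zero_near_scale)
    moreover have "eventually (\<lambda>n. card (?A l n) = l) sequentially"
      "eventually (\<lambda>n. card (?A m n) = m) sequentially"
      by (rule eventually_card_neg_zeros_eq[OF mult pos])+
    ultimately show ?thesis
      using eventually_ge_at_top[of 1]
    proof eventually_elim
      case (elim n)
      let ?s = "zero_scale lam m n" and ?N = "neg_zeros (stirling_poly lam n)"
      have fin: "finite ?N"
        using stirling_poly_neg_zeros(1)[OF mult pos elim(5)] .
      have s: "?s > 0" using pos \<open>m \<ge> 1\<close> by (rule zero_scale_pos)
      from elim(2) obtain z where z: "z \<in> ?N" "- ((1 + e) * ?s) < z" "z < - ((1 - e) * ?s)"
        by blast
      have "2 * zero_scale lam l n < (1 - e) * ?s" using elim(1) by (simp add: field_simps)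
      then have "?A l n \<subseteq> {a \<in> ?N. z < a}" using z by auto
      then have "l \<le> card {a \<in> ?N. z < a}"
        using card_mono[of "{a \<in> ?N. z < a}" "?A l n"] fin elim(3) by simp
      \<comment> \<open>Since \<open>e < 1\<close>, the located zero lies within twice the scale and
        is counted at index \<open>m\<close>.\<close>
      moreover have "e * ?s < 1 * ?s" using e s by (intro mult_strict_right_mono)
      then have "insert z {a \<in> ?N. z < a} \<subseteq> ?A m n"
        using z by (auto simp: algebra_simps)
      then have "Suc (card {a \<in> ?N. z < a}) \<le> m"
        using card_mono[of "?A m n" "insert z {a \<in> ?N. z < a}"] fin elim(4) by simp
      ultimately have "card {a \<in> ?N. z < a} = m - 1" using m by simp
      then have "zeta lam m n = z"
        unfolding zeta_def using fin z(1) by (intro rev_sorted_list_of_set_nth)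
      moreover have "\<bar>z / - ?s - 1\<bar> < e"
        using z s by (simp add: abs_less_iff field_simps)
      ultimately show ?case by simp
    qed
  qed
  note small = this
  show ?thesis
  proof (rule tendstoI)
    fix e :: real assume "e > 0"
    \<comment> \<open>The minimum with 1/2 keeps the tolerance below 1, as \<open>small\<close>
      demands.\<close>
    then have "eventually (\<lambda>n. \<bar>zeta lam m n / - zero_scale lam m n - 1\<bar> < min e (1/2)) sequentially"
      by (intro small) auto
    then show "eventually (\<lambda>n. dist (zeta lam m n / - zero_scale lam m n) 1 < e) sequentially"
      by eventually_elim (simp add: dist_real_def)
  qed
qed

theorem theorem2p1:
  fixes lam :: "nat \<Rightarrow> real"
  assumes "multiplier_sequence lam"
    and "\<And>n. lam n > 0"
  shows "(\<forall>n\<ge>1. poly (stirling_poly lam n) 0 = 0 \<and>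
            card (neg_zeros (stirling_poly lam n)) = n - 1 \<and>
            (\<forall>x \<in> neg_zeros (stirling_poly lam n). order x (stirling_poly lam n) = 1)) \<and>
         (\<forall>m\<ge>1. (\<lambda>n. zeta lam m n / (- (lam m / lam (Suc m)) * (real m / real (Suc m)) ^ n))
            \<longlonglongrightarrow> 1)"
proof (intro conjI allI impI ballI)
  fix n :: nat assume "n \<ge> 1"
  with stirling_poly_roots(1)[of lam, OF assms(2)] stirling_poly_neg_zeros(2,3)[OF assms]
  show "poly (stirling_poly lam n) 0 = 0"
    and "card (neg_zeros (stirling_poly lam n)) = n - 1"
    and "\<And>x. x \<in> neg_zeros (stirling_poly lam n) \<Longrightarrow> order x (stirling_poly lam n) = 1"
    by blast+
next
  fix m :: nat assume "m \<ge> 1"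
  with zeta_div_zero_scale_tendsto[OF assms]
  show "(\<lambda>n. zeta lam m n / (- (lam m / lam (Suc m)) * (real m / real (Suc m)) ^ n)) \<longlonglongrightarrow> 1"
    by (simp only: zero_scale_def minus_mult_left)
qed

end
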